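(* Let $H$ and $K$ be groups, let $K$ act on $H$ by automorphisms, and let $G = H\rtimes K$ be the corresponding semidirect product. Let $\mathcal{M}$ be the monoid of $2\times 2$ matrices of maps defined in the context. Then $End(G)$ (the monoid of endomorphisms of $G$ under composition) and $\mathcal{M}$ are isomorphic as monoids.
   Context: The action of $k\in K$ on $h\in H$ is written $h^{k}$; identifying $H$ and $K$ with subgroups of $G = H\rtimes K$, $h^{k}=khk^{-1}$, and every element of $G$ is uniquely $hk$ with $h\in H$, $k\in K$. $Map(U,V)$ is the set of all maps from $U$ to $V$. Maps are added pointwise: $(\phi+\psi)(u)=\phi(u)\psi(u)$ (in this order); juxtaposition of maps is composition; for $\phi: U\to H$ and $\psi: U\to K$, $\phi^{\psi}:U\to H$ is $u\mapsto \phi(u)^{\psi(u)}$. $\mathcal{M}$ is the set of matrices $\begin{pmatrix}\alpha&\beta\\ \gamma&\delta\end{pmatrix}$ with $\alpha\in Map(H,H)$, $\beta\in Map(K,H)$, $\gamma\in Hom(H,K)$, $\delta\in End(K)$ such that for all $h,h'\in H$, $k,k'\in K$: (i) $\alpha(hh')=\alpha(h)\alpha(h')^{\gamma(h)}$; (ii) $\beta(kk')=\beta(k)\beta(k')^{\delta(k)}$; (iii) $\gamma(h^{k})\delta(k)=\delta(k)\gamma(h)$; (iv) $\alpha(h^{k})\beta(k)^{\gamma(h^{k})}=\beta(k)\alpha(h)^{\delta(k)}$. The monoid operation on $\mathcal{M}$ is $$\begin{pmatrix}\alpha'&\beta'\\ \gamma'&\delta'\end{pmatrix}\begin{pmatrix}\alpha&\beta\\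 \gamma&\delta\end{pmatrix}=\begin{pmatrix}\alpha'\alpha+(\beta'\gamma)^{\gamma'\alpha} & \alpha'\beta+(\beta'\delta)^{\gamma'\beta}\\ \gamma'\alpha+\delta'\gamma & \gamma'\beta+\delta'\delta\end{pmatrix},$$ with identity element $\begin{pmatrix}1&0\\0&1\end{pmatrix}$, where $1$ is the identity map and $0$ the trivial map. *)

theory Defs
  imports "HOL-Algebra.Bij"
begin

text \<open>
  An action of \<open>K\<close> on \<open>H\<close> by automorphisms is an element \<open>act\<close> of
  \<open>hom K (AutoGroup H)\<close>, and \<open>act k h\<close> is the element written $h^k$ on paper.
  The product in \<open>AutoGroup H\<close> is composition, so this is a left action:
  \<open>act (k \<otimes> k') h = act k (act k' h)\<close>, as forced by $h^k = k h k^{-1}$ in the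
  semidirect product.  The pair \<open>(h, k)\<close> stands for the element $hk$, whence
  $(hk)(h'k') = h\,h'^{k}\,kk'$.
\<close>

definition semidirect ::
  "('h, 'm) monoid_scheme \<Rightarrow> ('k, 'n) monoid_scheme \<Rightarrow> ('k \<Rightarrow> 'h \<Rightarrow> 'h) \<Rightarrow> ('h \<times> 'k) monoid"
  where "semidirect H K act =
    \<lparr>carrier = carrier H \<times> carrier K,
     mult = \<lambda>(h, k) (h', k'). (h \<otimes>\<^bsub>H\<^esub> act k h', k \<otimes>\<^bsub>K\<^esub> k'),
     one = (\<one>\<^bsub>H\<^esub>, \<one>\<^bsub>K\<^esub>)\<rparr>"

lemma group_semidirect:
  fixes H (structure) and K (structure)
  assumes H: "group H" and K: "group K" and act: "act \<in> hom K (AutoGroup H)"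
  shows "group (semidirect H K act)"
proof -
  interpret H: group H by (rule H)
  interpret K: group K by (rule K)
  interpret A: group_hom K "AutoGroup H" act
    using K H.AutoGroup act by (simp add: group_hom_def group_hom_axioms_def)
  have aut: "act k \<in> auto H" if "k \<in> carrier K" for k
    using A.hom_closed[OF that] by (simp add: AutoGroup_def)
  have cl: "act k h \<in> carrier H" if "k \<in> carrier K" "h \<in> carrier H" for k h
    using aut[OF that(1)] that(2) by (auto simp: auto_def hom_def)
  have mul: "act k (h \<otimes>\<^bsub>H\<^esub> h') = act k h \<otimes>\<^bsub>H\<^esub> act k h'"
    if "k \<in> carrier K" "h \<in> carrier H" "h' \<in> carrier H" for k h h'
    using aut[OF that(1)] that by (auto simp: auto_def hom_def)
  have comp: "act (k \<otimes>\<^bsub>K\<^esub> k') h = act k (act k' h)"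
    if "k \<in> carrier K" "k' \<in> carrier K" "h \<in> carrier H" for k k' h
    using A.hom_mult[OF that(1,2)] aut[OF that(1)] aut[OF that(2)] that(3)
    by (simp add: AutoGroup_def BijGroup_def auto_def compose_def)
  have one: "act \<one>\<^bsub>K\<^esub> h = h" if "h \<in> carrier H" for h
    using A.hom_one that by (simp add: AutoGroup_def BijGroup_def)
  note A.hom_inv[simp del] A.hom_one[simp del] A.hom_mult[simp del]
  show ?thesis
  proof (rule groupI)
    fix x assume x: "x \<in> carrier (semidirect H K act)"
    obtain h k where hk: "x = (h, k)" "h \<in> carrier H" "k \<in> carrier K"
      using x by (auto simp: semidirect_def)
    let ?y = "(act (inv\<^bsub>K\<^esub> k) (inv\<^bsub>H\<^esub> h), inv\<^bsub>K\<^esub> k)"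
    have "?y \<in> carrier (semidirect H K act)"
      using hk cl by (simp add: semidirect_def)
    moreover have "?y \<otimes>\<^bsub>semidirect H K act\<^esub> x = \<one>\<^bsub>semidirect H K act\<^esub>"
    proof -
      have h0: "act (inv\<^bsub>K\<^esub> k) \<one>\<^bsub>H\<^esub> \<otimes>\<^bsub>H\<^esub> act (inv\<^bsub>K\<^esub> k) \<one>\<^bsub>H\<^esub> = act (inv\<^bsub>K\<^esub> k) \<one>\<^bsub>H\<^esub>"
        using mul[of "inv\<^bsub>K\<^esub> k" "\<one>\<^bsub>H\<^esub>" "\<one>\<^bsub>H\<^esub>"] hk by simp
      have "act (inv\<^bsub>K\<^esub> k) \<one>\<^bsub>H\<^esub> = \<one>\<^bsub>H\<^esub>"
        using h0 cl hk H.l_cancel_one by simp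
      thus ?thesis
        using hk mul[of "inv\<^bsub>K\<^esub> k" "inv\<^bsub>H\<^esub> h" h] by (simp add: semidirect_def)
    qed
    ultimately show "\<exists>y\<in>carrier (semidirect H K act).
        y \<otimes>\<^bsub>semidirect H K act\<^esub> x = \<one>\<^bsub>semidirect H K act\<^esub>" by blast
  qed (auto simp: semidirect_def cl mul comp one H.m_assoc K.m_assoc)
qed

text \<open>
  As for \<^const>\<open>BijGroup\<close>, a map on a carrier is represented by the function that is
  \<^const>\<open>undefined\<close> off that carrier, so that equality of maps is equality in HOL.
\<close>

definition EndMonoid :: "('a, 'm) monoid_scheme \<Rightarrow> ('a \<Rightarrow> 'a) monoid"
  where "EndMonoid G =
    \<lparr>carrier = hom G G \<inter> extensional (carrier G),
     mult = compose (carrier G),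
     one = \<lambda>x\<in>carrier G. x\<rparr>"

definition map_plus ::
  "'u set \<Rightarrow> ('v, 'm) monoid_scheme \<Rightarrow> ('u \<Rightarrow> 'v) \<Rightarrow> ('u \<Rightarrow> 'v) \<Rightarrow> 'u \<Rightarrow> 'v"
  where "map_plus U V \<phi> \<psi> = (\<lambda>u\<in>U. \<phi> u \<otimes>\<^bsub>V\<^esub> \<psi> u)"

text \<open>The map $\phi^\psi$, that is, $u \mapsto \phi(u)^{\psi(u)}$.\<close>

definition map_pow ::
  "'u set \<Rightarrow> ('k \<Rightarrow> 'h \<Rightarrow> 'h) \<Rightarrow> ('u \<Rightarrow> 'h) \<Rightarrow> ('u \<Rightarrow> 'k) \<Rightarrow> 'u \<Rightarrow> 'h"
  where "map_pow U act \<phi> \<psi> = (\<lambda>u\<in>U. act (\<psi> u) (\<phi> u))"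

text \<open>Entries are listed row by row.\<close>

datatype ('h, 'k) map_matrix = Matrix "'h \<Rightarrow> 'h" "'k \<Rightarrow> 'h" "'h \<Rightarrow> 'k" "'k \<Rightarrow> 'k"

definition map_matrices ::
  "('h, 'm) monoid_scheme \<Rightarrow> ('k, 'n) monoid_scheme \<Rightarrow> ('k \<Rightarrow> 'h \<Rightarrow> 'h) \<Rightarrow> ('h, 'k) map_matrix set"
  where "map_matrices H K act =
    {Matrix \<alpha> \<beta> \<gamma> \<delta> | \<alpha> \<beta> \<gamma> \<delta>.
      \<alpha> \<in> carrier H \<rightarrow>\<^sub>E carrier H \<and>
      \<beta> \<in> carrier K \<rightarrow>\<^sub>E carrier H \<and>
      \<gamma> \<in> hom H K \<inter> extensional (carrier H) \<and>
      \<delta> \<in> hom K K \<inter> extensional (carrier K) \<and>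
      (\<forall>h\<in>carrier H. \<forall>h'\<in>carrier H.
        \<alpha> (h \<otimes>\<^bsub>H\<^esub> h') = \<alpha> h \<otimes>\<^bsub>H\<^esub> act (\<gamma> h) (\<alpha> h')) \<and>
      (\<forall>k\<in>carrier K. \<forall>k'\<in>carrier K.
        \<beta> (k \<otimes>\<^bsub>K\<^esub> k') = \<beta> k \<otimes>\<^bsub>H\<^esub> act (\<delta> k) (\<beta> k')) \<and>
      (\<forall>h\<in>carrier H. \<forall>k\<in>carrier K.
        \<gamma> (act k h) \<otimes>\<^bsub>K\<^esub> \<delta> k = \<delta> k \<otimes>\<^bsub>K\<^esub> \<gamma> h) \<and>
      (\<forall>h\<in>carrier H. \<forall>k\<in>carrier K.
        \<alpha> (act k h) \<otimes>\<^bsub>H\<^esub> act (\<gamma> (act k h)) (\<beta> k) = \<beta> k \<otimes>\<^bsub>H\<^esub> act (\<delta> k) (\<alpha> h))}"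

fun matrix_mult ::
  "('h, 'm) monoid_scheme \<Rightarrow> ('k, 'n) monoid_scheme \<Rightarrow> ('k \<Rightarrow> 'h \<Rightarrow> 'h)
    \<Rightarrow> ('h, 'k) map_matrix \<Rightarrow> ('h, 'k) map_matrix \<Rightarrow> ('h, 'k) map_matrix"
  where "matrix_mult H K act (Matrix \<alpha>' \<beta>' \<gamma>' \<delta>') (Matrix \<alpha> \<beta> \<gamma> \<delta>) =
    (let X = carrier H; Y = carrier K in
     Matrix
      (map_plus X H (compose X \<alpha>' \<alpha>) (map_pow X act (compose X \<beta>' \<gamma>) (compose X \<gamma>' \<alpha>)))
      (map_plus Y H (compose Y \<alpha>' \<beta>) (map_pow Y act (compose Y \<beta>' \<delta>) (compose Y \<gamma>' \<beta>)))
      (map_plus X K (compose X \<gamma>' \<alpha>) (compose X \<delta>' \<gamma>))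
      (map_plus Y K (compose Y \<gamma>' \<beta>) (compose Y \<delta>' \<delta>)))"

definition MatrixMonoid ::
  "('h, 'm) monoid_scheme \<Rightarrow> ('k, 'n) monoid_scheme \<Rightarrow> ('k \<Rightarrow> 'h \<Rightarrow> 'h) \<Rightarrow> ('h, 'k) map_matrix monoid"
  where "MatrixMonoid H K act =
    \<lparr>carrier = map_matrices H K act,
     mult = matrix_mult H K act,
     one = Matrix (\<lambda>h\<in>carrier H. h) (\<lambda>k\<in>carrier K. \<one>\<^bsub>H\<^esub>)
                  (\<lambda>h\<in>carrier H. \<one>\<^bsub>K\<^esub>) (\<lambda>k\<in>carrier K. k)\<rparr>"

end

theory Submission
  imports Defs
begin

text \<open>
  Since \<open>(h, k) = (h, \<one>) (\<one>, k)\<close>, an endomorphism \<open>\<phi>\<close> is determined by its restrictions to the two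
  factors, and the components of these restrictions are the columns of a matrix.  Conditions
  (i)--(ii), together with \<open>\<gamma>\<close> and \<open>\<delta>\<close> being homomorphisms, say that the restrictions are
  homomorphisms into the semidirect product, and (iii)--(iv) say that they respect the
  relation \<open>(\<one>, k) (h, \<one>) = (act k h, \<one>) (\<one>, k)\<close>; evaluating \<open>\<phi>\<close> at \<open>\<psi> (h, \<one>)\<close> and \<open>\<psi> (\<one>, k)\<close>
  gives the product formula.  The matrices inherit the monoid laws through the bijection.
\<close>

text \<open>The unit laws hold as equalities of HOL functions because elements of the carrier are
  extensional: composing with the restricted identity changes nothing on or off
  \<open>carrier G\<close>.\<close>

lemma monoid_EndMonoid:
  assumes "monoid G"
  shows "monoid (EndMonoid G)"
proof -
  interpret monoid G by (rule assms)
  show ?thesis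
  proof (rule monoidI)
    fix x y z assume "x \<in> carrier (EndMonoid G)" "y \<in> carrier (EndMonoid G)"
      "z \<in> carrier (EndMonoid G)"
    then show "x \<otimes>\<^bsub>EndMonoid G\<^esub> y \<otimes>\<^bsub>EndMonoid G\<^esub> z = x \<otimes>\<^bsub>EndMonoid G\<^esub> (y \<otimes>\<^bsub>EndMonoid G\<^esub> z)"
      by (auto simp: EndMonoid_def hom_def intro!: compose_assoc[symmetric])
  qed (auto simp: EndMonoid_def hom_def compose_def extensional_def Pi_def fun_eq_iff)
qed

section \<open>Arithmetic of the action and of the semidirect product\<close>

locale semidirect_product = H: group H + K: group K
  for H :: "('h, 'm) monoid_scheme" and K :: "('k, 'n) monoid_scheme" +
  fixes act :: "'k \<Rightarrow> 'h \<Rightarrow> 'h"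
  assumes act_hom: "act \<in> hom K (AutoGroup H)"
begin

abbreviation G :: "('h \<times> 'k) monoid" where "G \<equiv> semidirect H K act"

sublocale G: group G
  by (rule group_semidirect[OF H.group_axioms K.group_axioms act_hom])

lemma act_auto: "k \<in> carrier K \<Longrightarrow> act k \<in> auto H"
  using act_hom by (auto simp: hom_def AutoGroup_def)

lemma act_closed [simp, intro]:
  "k \<in> carrier K \<Longrightarrow> h \<in> carrier H \<Longrightarrow> act k h \<in> carrier H"
  using act_auto by (auto simp: auto_def hom_def)

lemma act_mult:
  "\<lbrakk>k \<in> carrier K; h \<in> carrier H; h' \<in> carrier H\<rbrakk>
    \<Longrightarrow> act k (h \<otimes>\<^bsub>H\<^esub> h') = act k h \<otimes>\<^bsub>H\<^esub> act k h'"
  using act_auto[of k] by (auto simp: auto_def hom_def)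

text \<open>The element \<open>act k \<one>\<close> is idempotent, and the only idempotent of a
  group is its identity.\<close>

lemma act_one [simp]: "k \<in> carrier K \<Longrightarrow> act k \<one>\<^bsub>H\<^esub> = \<one>\<^bsub>H\<^esub>"
  using act_mult[of k "\<one>\<^bsub>H\<^esub>" "\<one>\<^bsub>H\<^esub>"] H.l_cancel_one[of "act k \<one>\<^bsub>H\<^esub>" "act k \<one>\<^bsub>H\<^esub>"] by simp

lemma act_act:
  assumes "k \<in> carrier K" "k' \<in> carrier K" "h \<in> carrier H"
  shows "act (k \<otimes>\<^bsub>K\<^esub> k') h = act k (act k' h)"
  using act_hom act_auto[of k] act_auto[of k'] assms
  by (auto simp: hom_def AutoGroup_def BijGroup_def auto_def compose_def restrict_def)

lemma one_act [simp]:
  assumes "h \<in> carrier H"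
  shows "act \<one>\<^bsub>K\<^esub> h = h"
proof -
  have "group_hom K (AutoGroup H) act"
    using act_hom H.AutoGroup K.group_axioms by (simp add: group_hom_def group_hom_axioms_def)
  then have "act \<one>\<^bsub>K\<^esub> = \<one>\<^bsub>AutoGroup H\<^esub>"
    by (rule group_hom.hom_one)
  with assms show ?thesis by (simp add: AutoGroup_def BijGroup_def)
qed

lemma carrier_G [simp]: "carrier G = carrier H \<times> carrier K"
  by (simp add: semidirect_def)

text \<open>Stated with projections so that it also rewrites products whose factors are not literal
  pairs, such as values of an endomorphism.\<close>

lemma mult_G: "x \<otimes>\<^bsub>G\<^esub> y = (fst x \<otimes>\<^bsub>H\<^esub> act (snd x) (fst y), snd x \<otimes>\<^bsub>K\<^esub> snd y)"
  by (simp add: semidirect_def case_prod_beta)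

section \<open>From endomorphisms to matrices\<close>

definition matrix_of :: "('h \<times> 'k \<Rightarrow> 'h \<times> 'k) \<Rightarrow> ('h, 'k) map_matrix"
  where "matrix_of \<phi> = Matrix
    (\<lambda>h\<in>carrier H. fst (\<phi> (h, \<one>\<^bsub>K\<^esub>))) (\<lambda>k\<in>carrier K. fst (\<phi> (\<one>\<^bsub>H\<^esub>, k)))
    (\<lambda>h\<in>carrier H. snd (\<phi> (h, \<one>\<^bsub>K\<^esub>))) (\<lambda>k\<in>carrier K. snd (\<phi> (\<one>\<^bsub>H\<^esub>, k)))"

text \<open>The value is left as a product in \<open>G\<close> of the images of the two factors, so
  that associativity in \<open>G\<close> can replace computation with components.\<close>

fun end_of :: "('h, 'k) map_matrix \<Rightarrow> 'h \<times> 'k \<Rightarrow> 'h \<times> 'k"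
  where "end_of (Matrix \<alpha> \<beta> \<gamma> \<delta>) =
    (\<lambda>x\<in>carrier H \<times> carrier K. (\<alpha> (fst x), \<gamma> (fst x)) \<otimes>\<^bsub>G\<^esub> (\<beta> (snd x), \<delta> (snd x)))"

lemma hom_G_mem:
  assumes "\<phi> \<in> hom G G" "h \<in> carrier H" "k \<in> carrier K"
  shows "fst (\<phi> (h, k)) \<in> carrier H" "snd (\<phi> (h, k)) \<in> carrier K"
  using hom_in_carrier[OF assms(1), of "(h, k)"] assms(2,3) by (auto simp: mem_Times_iff)

lemma hom_G_split:
  assumes "\<phi> \<in> hom G G" "h \<in> carrier H" "k \<in> carrier K"
  shows "\<phi> (h, k) = \<phi> (h, \<one>\<^bsub>K\<^esub>) \<otimes>\<^bsub>G\<^esub> \<phi> (\<one>\<^bsub>H\<^esub>, k)"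
proof -
  have "(h, k) = (h, \<one>\<^bsub>K\<^esub>) \<otimes>\<^bsub>G\<^esub> (\<one>\<^bsub>H\<^esub>, k)"
    using assms by (simp add: mult_G)
  then show ?thesis
    using hom_mult[OF assms(1), of "(h, \<one>\<^bsub>K\<^esub>)" "(\<one>\<^bsub>H\<^esub>, k)"] assms by simp
qed

text \<open>The first components of \<open>hh\<close>, \<open>kk\<close> and \<open>hk\<close> are
  (i), (ii) and (iv); the second components are multiplicativity of \<gamma>, multiplicativity of
  \<delta>, and (iii).\<close>

lemma matrix_of_closed:
  assumes "\<phi> \<in> hom G G"
  shows "matrix_of \<phi> \<in> map_matrices H K act"
proof -
  note mem = hom_G_mem[OF assms]
  have hh: "\<phi> (h \<otimes>\<^bsub>H\<^esub> h', \<one>\<^bsub>K\<^esub>) = \<phi> (h, \<one>\<^bsub>K\<^esub>) \<otimes>\<^bsub>G\<^esub> \<phi> (h', \<one>\<^bsub>K\<^esub>)"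
    if "h \<in> carrier H" "h' \<in> carrier H" for h h'
    using hom_mult[OF assms, of "(h, \<one>\<^bsub>K\<^esub>)" "(h', \<one>\<^bsub>K\<^esub>)"] that
    by (simp add: mult_G)
  have kk: "\<phi> (\<one>\<^bsub>H\<^esub>, k \<otimes>\<^bsub>K\<^esub> k') = \<phi> (\<one>\<^bsub>H\<^esub>, k) \<otimes>\<^bsub>G\<^esub> \<phi> (\<one>\<^bsub>H\<^esub>, k')"
    if "k \<in> carrier K" "k' \<in> carrier K" for k k'
    using hom_mult[OF assms, of "(\<one>\<^bsub>H\<^esub>, k)" "(\<one>\<^bsub>H\<^esub>, k')"] that
    by (simp add: mult_G)
  \<comment> \<open>Both sides equal \<open>\<phi> (act k h, k)\<close>: the left by splitting the
    argument, the right because \<open>(\<one>, k) (h, \<one>) = (act k h, k)\<close>.\<close>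
  have hk: "\<phi> (act k h, \<one>\<^bsub>K\<^esub>) \<otimes>\<^bsub>G\<^esub> \<phi> (\<one>\<^bsub>H\<^esub>, k) = \<phi> (\<one>\<^bsub>H\<^esub>, k) \<otimes>\<^bsub>G\<^esub> \<phi> (h, \<one>\<^bsub>K\<^esub>)"
    if "h \<in> carrier H" "k \<in> carrier K" for h k
    using hom_mult[OF assms, of "(\<one>\<^bsub>H\<^esub>, k)" "(h, \<one>\<^bsub>K\<^esub>)"] that
      hom_G_split[OF assms, of "act k h" k]
    by (simp add: mult_G)
  show ?thesis
    using mem hh kk hk
    by (auto simp: map_matrices_def matrix_of_def mult_G hom_def)
qed

lemma matrix_of_compose:
  assumes \<phi>: "\<phi> \<in> hom G G" and \<psi>: "\<psi> \<in> hom G G"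
  shows "matrix_of (compose (carrier G) \<phi> \<psi>) = matrix_mult H K act (matrix_of \<phi>) (matrix_of \<psi>)"
proof -
  \<comment> \<open>Even at \<open>(h, \<one>)\<close> the value of \<psi> may have two nontrivial
    components, so \<phi> has to be split there. Its two factors give the two summands in each entry
    of the product matrix, and multiplying them in \<open>G\<close> produces the exponent.\<close>
  have split: "\<phi> (\<psi> (h, k)) =
      \<phi> (fst (\<psi> (h, k)), \<one>\<^bsub>K\<^esub>) \<otimes>\<^bsub>G\<^esub> \<phi> (\<one>\<^bsub>H\<^esub>, snd (\<psi> (h, k)))"
    if "h \<in> carrier H" "k \<in> carrier K" for h k
    using hom_G_split[OF \<phi> hom_G_mem[OF \<psi> that]] by simp
  show ?thesis
    by (auto simp: matrix_of_def Let_def map_plus_def map_pow_def compose_def fun_eq_iff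
        hom_G_mem[OF \<psi>] split mult_G)
qed

lemma end_of_matrix_of:
  assumes "\<phi> \<in> hom G G" "\<phi> \<in> extensional (carrier G)"
  shows "end_of (matrix_of \<phi>) = \<phi>"
proof
  fix x
  show "end_of (matrix_of \<phi>) x = \<phi> x"
  proof (cases "x \<in> carrier G")
    case True
    then obtain h k where "x = (h, k)" "h \<in> carrier H" "k \<in> carrier K"
      by auto
    then show ?thesis
      by (simp add: matrix_of_def mult_G hom_G_split[OF assms(1), of h k])
  next
    case False
    then show ?thesis
      using extensional_arb[OF assms(2) False] by (simp add: matrix_of_def)
  qed
qed

section \<open>From matrices to endomorphisms\<close>

lemma map_matricesE:
  assumes "M \<in> map_matrices H K act"
  obtains \<alpha> \<beta> \<gamma> \<delta> where "M = Matrix \<alpha> \<beta> \<gamma> \<delta>"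
    and "\<alpha> \<in> carrier H \<rightarrow>\<^sub>E carrier H" and "\<beta> \<in> carrier K \<rightarrow>\<^sub>E carrier H"
    and "\<gamma> \<in> hom H K" "\<gamma> \<in> extensional (carrier H)"
    and "\<delta> \<in> hom K K" "\<delta> \<in> extensional (carrier K)"
    and "\<And>h h'. h \<in> carrier H \<Longrightarrow> h' \<in> carrier H \<Longrightarrow>
      \<alpha> (h \<otimes>\<^bsub>H\<^esub> h') = \<alpha> h \<otimes>\<^bsub>H\<^esub> act (\<gamma> h) (\<alpha> h')"
    and "\<And>k k'. k \<in> carrier K \<Longrightarrow> k' \<in> carrier K \<Longrightarrow>
      \<beta> (k \<otimes>\<^bsub>K\<^esub> k') = \<beta> k \<otimes>\<^bsub>H\<^esub> act (\<delta> k) (\<beta> k')"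
    and "\<And>h k. h \<in> carrier H \<Longrightarrow> k \<in> carrier K \<Longrightarrow>
      \<gamma> (act k h) \<otimes>\<^bsub>K\<^esub> \<delta> k = \<delta> k \<otimes>\<^bsub>K\<^esub> \<gamma> h"
    and "\<And>h k. h \<in> carrier H \<Longrightarrow> k \<in> carrier K \<Longrightarrow>
      \<alpha> (act k h) \<otimes>\<^bsub>H\<^esub> act (\<gamma> (act k h)) (\<beta> k) = \<beta> k \<otimes>\<^bsub>H\<^esub> act (\<delta> k) (\<alpha> h)"
  using assms unfolding map_matrices_def
  by (elim CollectE exE conjE IntE) (rule that, assumption+, blast+)

lemma end_of_closed:
  assumes "M \<in> map_matrices H K act"
  shows "end_of M \<in> hom G G \<inter> extensional (carrier G)"
  using assms
proof (rule map_matricesE)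
  fix \<alpha> \<beta> \<gamma> \<delta>
  assume M: "M = Matrix \<alpha> \<beta> \<gamma> \<delta>"
    and \<alpha>: "\<alpha> \<in> carrier H \<rightarrow>\<^sub>E carrier H" and \<beta>: "\<beta> \<in> carrier K \<rightarrow>\<^sub>E carrier H"
    and \<gamma>: "\<gamma> \<in> hom H K" and \<delta>: "\<delta> \<in> hom K K"
    and i: "\<And>h h'. h \<in> carrier H \<Longrightarrow> h' \<in> carrier H \<Longrightarrow>
      \<alpha> (h \<otimes>\<^bsub>H\<^esub> h') = \<alpha> h \<otimes>\<^bsub>H\<^esub> act (\<gamma> h) (\<alpha> h')"
    and ii: "\<And>k k'. k \<in> carrier K \<Longrightarrow> k' \<in> carrier K \<Longrightarrow>
      \<beta> (k \<otimes>\<^bsub>K\<^esub> k') = \<beta> k \<otimes>\<^bsub>H\<^esub> act (\<delta> k) (\<beta> k')"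
    and iii: "\<And>h k. h \<in> carrier H \<Longrightarrow> k \<in> carrier K \<Longrightarrow>
      \<gamma> (act k h) \<otimes>\<^bsub>K\<^esub> \<delta> k = \<delta> k \<otimes>\<^bsub>K\<^esub> \<gamma> h"
    and iv: "\<And>h k. h \<in> carrier H \<Longrightarrow> k \<in> carrier K \<Longrightarrow>
      \<alpha> (act k h) \<otimes>\<^bsub>H\<^esub> act (\<gamma> (act k h)) (\<beta> k) = \<beta> k \<otimes>\<^bsub>H\<^esub> act (\<delta> k) (\<alpha> h)"
  note [simp] = PiE_mem[OF \<alpha>] PiE_mem[OF \<beta>] hom_in_carrier[OF \<gamma>] hom_in_carrier[OF \<delta>]
  \<comment> \<open>The columns of the matrix, read as maps into \<open>G\<close>; the facts
    \<open>a\<close>, \<open>b\<close> and \<open>ab\<close> restate the matrix conditions as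
    identities in \<open>G\<close>.\<close>
  define a where "a h = (\<alpha> h, \<gamma> h)" for h
  define b where "b k = (\<beta> k, \<delta> k)" for k
  have a_cl: "a h \<in> carrier G" if "h \<in> carrier H" for h
    using that by (simp add: a_def)
  have b_cl: "b k \<in> carrier G" if "k \<in> carrier K" for k
    using that by (simp add: b_def)
  have a: "a (h \<otimes>\<^bsub>H\<^esub> h') = a h \<otimes>\<^bsub>G\<^esub> a h'" if "h \<in> carrier H" "h' \<in> carrier H" for h h'
    using that by (simp add: a_def mult_G hom_mult[OF \<gamma>] i)
  have b: "b (k \<otimes>\<^bsub>K\<^esub> k') = b k \<otimes>\<^bsub>G\<^esub> b k'" if "k \<in> carrier K" "k' \<in> carrier K" for k k'
    using that by (simp add: b_def mult_G hom_mult[OF \<delta>] ii)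
  have ab: "a (act k h) \<otimes>\<^bsub>G\<^esub> b k = b k \<otimes>\<^bsub>G\<^esub> a h" if "h \<in> carrier H" "k \<in> carrier K" for h k
    using that by (simp add: a_def b_def mult_G iii iv)
  have mult: "a (h \<otimes>\<^bsub>H\<^esub> act k h') \<otimes>\<^bsub>G\<^esub> b (k \<otimes>\<^bsub>K\<^esub> k') = a h \<otimes>\<^bsub>G\<^esub> b k \<otimes>\<^bsub>G\<^esub> (a h' \<otimes>\<^bsub>G\<^esub> b k')"
    if h: "h \<in> carrier H" "h' \<in> carrier H" and k: "k \<in> carrier K" "k' \<in> carrier K" for h h' k k'
  proof -
    note cls = h k a_cl b_cl G.m_closed act_closed
    have "a (h \<otimes>\<^bsub>H\<^esub> act k h') \<otimes>\<^bsub>G\<^esub> b (k \<otimes>\<^bsub>K\<^esub> k')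
        = a h \<otimes>\<^bsub>G\<^esub> (a (act k h') \<otimes>\<^bsub>G\<^esub> b k) \<otimes>\<^bsub>G\<^esub> b k'"
      \<comment> \<open>Keeping \<open>carrier G\<close> folded lets the closure facts discharge the
        side conditions of associativity in \<open>G\<close>.\<close>
      by (simp add: a b G.m_assoc cls del: carrier_G)
    also have "\<dots> = a h \<otimes>\<^bsub>G\<^esub> b k \<otimes>\<^bsub>G\<^esub> (a h' \<otimes>\<^bsub>G\<^esub> b k')"
      \<comment> \<open>Here \<open>ab\<close> moves \<open>b k\<close> to the left past the image
        of \<open>h'\<close>, which undoes the action of \<open>k\<close>.\<close>
      by (simp add: ab G.m_assoc cls del: carrier_G)
    finally show ?thesis .
  qed
  have M': "end_of M = (\<lambda>x\<in>carrier G. a (fst x) \<otimes>\<^bsub>G\<^esub> b (snd x))"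
    by (simp add: M a_def b_def)
  have "end_of M \<in> hom G G"
  proof (rule homI)
    fix x y assume x: "x \<in> carrier G" and y: "y \<in> carrier G"
    show "end_of M x \<in> carrier G"
      unfolding M' using x G.m_closed[OF a_cl b_cl, of "fst x" "snd x"] by auto
    have "end_of M (x \<otimes>\<^bsub>G\<^esub> y) = a (fst (x \<otimes>\<^bsub>G\<^esub> y)) \<otimes>\<^bsub>G\<^esub> b (snd (x \<otimes>\<^bsub>G\<^esub> y))"
      unfolding M' using G.m_closed[OF x y] by simp
    also have "\<dots> = a (fst x) \<otimes>\<^bsub>G\<^esub> b (snd x) \<otimes>\<^bsub>G\<^esub> (a (fst y) \<otimes>\<^bsub>G\<^esub> b (snd y))"
      using x y mult[of "fst x" "fst y" "snd x" "snd y"] by (auto simp: mult_G[of x y])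
    also have "\<dots> = end_of M x \<otimes>\<^bsub>G\<^esub> end_of M y"
      unfolding M' using x y by simp
    finally show "end_of M (x \<otimes>\<^bsub>G\<^esub> y) = end_of M x \<otimes>\<^bsub>G\<^esub> end_of M y" .
  qed
  then show ?thesis by (simp add: M')
qed

lemma matrix_of_end_of:
  assumes "M \<in> map_matrices H K act"
  shows "matrix_of (end_of M) = M"
proof -
  obtain \<alpha> \<beta> \<gamma> \<delta> where M: "M = Matrix \<alpha> \<beta> \<gamma> \<delta>"
    and \<alpha>: "\<alpha> \<in> carrier H \<rightarrow>\<^sub>E carrier H" and \<beta>: "\<beta> \<in> carrier K \<rightarrow>\<^sub>E carrier H"
    and \<gamma>: "\<gamma> \<in> hom H K" "\<gamma> \<in> extensional (carrier H)"
    and \<delta>: "\<delta> \<in> hom K K" "\<delta> \<in> extensional (carrier K)"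
    and i: "\<alpha> (\<one>\<^bsub>H\<^esub> \<otimes>\<^bsub>H\<^esub> \<one>\<^bsub>H\<^esub>) = \<alpha> \<one>\<^bsub>H\<^esub> \<otimes>\<^bsub>H\<^esub> act (\<gamma> \<one>\<^bsub>H\<^esub>) (\<alpha> \<one>\<^bsub>H\<^esub>)"
    and ii: "\<beta> (\<one>\<^bsub>K\<^esub> \<otimes>\<^bsub>K\<^esub> \<one>\<^bsub>K\<^esub>) = \<beta> \<one>\<^bsub>K\<^esub> \<otimes>\<^bsub>H\<^esub> act (\<delta> \<one>\<^bsub>K\<^esub>) (\<beta> \<one>\<^bsub>K\<^esub>)"
    using map_matricesE[OF assms] H.one_closed K.one_closed by metis
  have \<gamma>1: "\<gamma> \<one>\<^bsub>H\<^esub> = \<one>\<^bsub>K\<^esub>" and \<delta>1: "\<delta> \<one>\<^bsub>K\<^esub> = \<one>\<^bsub>K\<^esub>"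
    using hom_one \<gamma>(1) \<delta>(1) H.group_axioms K.group_axioms by blast+
  have \<alpha>_cl: "\<alpha> h \<in> carrier H" if "h \<in> carrier H" for h using \<alpha> that by blast
  have \<beta>_cl: "\<beta> k \<in> carrier H" if "k \<in> carrier K" for k using \<beta> that by blast
  \<comment> \<open>As \<alpha> and \<beta> are only crossed homomorphisms, \<open>hom_one\<close>
    does not apply. With trivial exponents at the identity, \<open>i\<close> and \<open>ii\<close>
    make these values idempotent, hence trivial. So at \<open>(h, \<one>)\<close> and
    \<open>(\<one>, k)\<close> one factor of \<open>end_of M\<close> is the identity of
    \<open>G\<close>.\<close>
  have \<alpha>1: "\<alpha> \<one>\<^bsub>H\<^esub> = \<one>\<^bsub>H\<^esub>" and \<beta>1: "\<beta> \<one>\<^bsub>K\<^esub> = \<one>\<^bsub>H\<^esub>"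
    using i ii \<alpha>_cl \<beta>_cl by (simp_all add: \<gamma>1 \<delta>1)
  show ?thesis
    using \<alpha> \<beta> \<gamma> \<delta>
    by (auto simp: M matrix_of_def mult_G \<alpha>1 \<beta>1 \<gamma>1 \<delta>1 \<alpha>_cl \<beta>_cl hom_in_carrier fun_eq_iff
        PiE_def extensional_def)
qed

section \<open>The isomorphism of monoids\<close>

lemma matrix_of_one: "matrix_of \<one>\<^bsub>EndMonoid G\<^esub> = \<one>\<^bsub>MatrixMonoid H K act\<^esub>"
  by (auto simp: matrix_of_def EndMonoid_def MatrixMonoid_def)

lemma matrix_of_iso: "matrix_of \<in> iso (EndMonoid G) (MatrixMonoid H K act)"
proof (rule isoI)
  show "matrix_of \<in> hom (EndMonoid G) (MatrixMonoid H K act)"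
  proof (rule homI)
    fix \<phi> \<psi> assume "\<phi> \<in> carrier (EndMonoid G)" "\<psi> \<in> carrier (EndMonoid G)"
    then show "matrix_of \<phi> \<in> carrier (MatrixMonoid H K act)"
      and "matrix_of (\<phi> \<otimes>\<^bsub>EndMonoid G\<^esub> \<psi>) = matrix_of \<phi> \<otimes>\<^bsub>MatrixMonoid H K act\<^esub> matrix_of \<psi>"
      using matrix_of_closed matrix_of_compose by (auto simp: EndMonoid_def MatrixMonoid_def)
  qed
  show "bij_betw matrix_of (carrier (EndMonoid G)) (carrier (MatrixMonoid H K act))"
  proof (rule bij_betw_byWitness[where f' = end_of])
    show "\<forall>\<phi>\<in>carrier (EndMonoid G). end_of (matrix_of \<phi>) = \<phi>"
      using end_of_matrix_of by (simp add: EndMonoid_def)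
    show "\<forall>M\<in>carrier (MatrixMonoid H K act). matrix_of (end_of M) = M"
      using matrix_of_end_of by (simp add: MatrixMonoid_def)
    show "matrix_of ` carrier (EndMonoid G) \<subseteq> carrier (MatrixMonoid H K act)"
      using matrix_of_closed by (auto simp: EndMonoid_def MatrixMonoid_def)
    show "end_of ` carrier (MatrixMonoid H K act) \<subseteq> carrier (EndMonoid G)"
      using end_of_closed by (fastforce simp: EndMonoid_def MatrixMonoid_def)
  qed
qed

lemma monoid_MatrixMonoid: "monoid (MatrixMonoid H K act)"
proof -
  let ?E = "EndMonoid G" and ?M = "MatrixMonoid H K act"
  \<comment> \<open>The homomorphic image of a monoid is a monoid on the image carrier, with the
    image of the unit. Surjectivity and \<open>matrix_of_one\<close> identify this record with
    \<open>?M\<close>.\<close>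
  have "monoid (?M \<lparr>carrier := matrix_of ` carrier ?E, one := matrix_of \<one>\<^bsub>?E\<^esub>\<rparr>)"
    using monoid_EndMonoid[OF G.is_monoid] matrix_of_iso
    by (simp add: monoid.hom_imp_img_monoid iso_def)
  moreover have "matrix_of ` carrier ?E = carrier ?M"
    using matrix_of_iso by (simp add: iso_def bij_betw_def)
  ultimately show ?thesis
    by (simp add: matrix_of_one)
qed

end

theorem theorem2p1:
  fixes H :: "('h, 'm) monoid_scheme"
    and K :: "('k, 'n) monoid_scheme"
    and act :: "'k \<Rightarrow> 'h \<Rightarrow> 'h"
  assumes "group H"
    and "group K"
    and "act \<in> hom K (AutoGroup H)"
  shows "monoid (EndMonoid (semidirect H K act)) \<and>
    monoid (MatrixMonoid H K act) \<and>
    (\<exists>f \<in> iso (EndMonoid (semidirect H K act)) (MatrixMonoid H K act).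
      f \<one>\<^bsub>EndMonoid (semidirect H K act)\<^esub> = \<one>\<^bsub>MatrixMonoid H K act\<^esub>)"
proof -
  interpret semidirect_product H K act
    using assms by (simp add: semidirect_product_def semidirect_product_axioms_def)
  \<comment> \<open>Membership in \<open>iso\<close> concerns only the multiplication and
    bijectivity, so preservation of the unit is supplied by \<open>matrix_of_one\<close>.\<close>
  show ?thesis
    using monoid_EndMonoid[OF G.is_monoid] monoid_MatrixMonoid matrix_of_iso matrix_of_one by blast
qed

end
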